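(* Let $0\le r,t\le 1$ with $r^2+t^2=1$. Let $\{\omega_k^\uparrow\}_{k\in\mathbb Z}\cup\{\omega_k^\downarrow\}_{k\in\mathbb Z}$ be i.i.d. $\mathbb T$-valued random variables ($\mathbb T=\mathbb R/2\pi\mathbb Z$) distributed according to a probability measure $\mu$ on $\mathbb T$ such that $\mathbb E(e^{-i\omega_k^\uparrow})=\mathbb E(e^{-i\omega_k^\downarrow})=0$ ($\mu$ is otherwise arbitrary). Let $U_\omega(n,0)$ be the time-dependent random quantum walk evolution on $\mathbb C^2\otimes l^2(\mathbb Z)$ defined in the context, and let $\Psi_0=\varphi_0\otimes|0\rangle$ be of norm one, with $\varphi_0\in\mathbb C^2$. Then for any $L\in\mathbb N$, $$\lim_{n\to\infty}\frac{\mathbb E\big(\langle X^L\rangle_{\Psi_0}(n)\big)}{n^{L/2}}=D(L),$$ where $D(L)=0$ if $L$ is odd, and $D(L)=1\cdot3\cdot5\cdots(L-1)\,(t^2/r^2)^{L/2}$ if $L$ is even.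
   Context: Let $\{|\!\uparrow\rangle,|\!\downarrow\rangle\}$ be the canonical basis of $\mathbb C^2$ and $\{|k\rangle\}_{k\in\mathbb Z}$ that of $l^2(\mathbb Z)$. Let $P_\uparrow,P_\downarrow$ be the orthogonal projections onto $|\!\uparrow\rangle,|\!\downarrow\rangle$ and $$S=\sum_{k\in\mathbb Z}\left\{P_\uparrow\otimes|k+1\rangle\langle k|+P_\downarrow\otimes|k-1\rangle\langle k|\right\}.$$ Let $$C_k=\begin{pmatrix}e^{-i\omega_k^\uparrow}t&-e^{-i\omega_k^\uparrow}r\\ e^{-i\omega_k^\downarrow}r&e^{-i\omega_k^\downarrow}t\end{pmatrix}$$ in the basis $(|\!\uparrow\rangle,|\!\downarrow\rangle)$, $U_k=S(C_k\otimes\mathbb I)$, and $U_\omega(n,0)=U_nU_{n-1}\cdots U_2U_1$. The position operator is $X=\mathbb I\otimes x$ with $x|k\rangle=k|k\rangle$, and $\langle X^L\rangle_{\Psi_0}(n)=\langle\Psi_0,U_\omega(n,0)^*X^LU_\omega(n,0)\Psi_0\rangle$. $\mathbb E$ is expectation over the random phases.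
   Formalization: The case r = 0 (t = 1) is excluded: there t²/r² is undefined, and for odd L the limit claim fails (e.g. φ₀ = ↑, L = 1 gives n/√n → ∞ instead of 0). *)

theory Defs
  imports "HOL-Probability.Probability"
begin

definition angle_rel :: "real \<Rightarrow> real \<Rightarrow> bool" where
  "angle_rel x y \<longleftrightarrow> (\<exists>k::int. x - y = 2 * pi * of_int k)"

lemma equivp_angle_rel: "equivp angle_rel"
proof (rule equivpI)
  show "reflp angle_rel"
    by (auto simp: reflp_def angle_rel_def intro: exI[of _ 0])
  show "symp angle_rel"
  proof (rule sympI)
    fix x y assume "angle_rel x y"
    then obtain k :: int where "x - y = 2 * pi * of_int k" by (auto simp: angle_rel_def)
    then have "y - x = 2 * pi * of_int (- k)" by simp
    then show "angle_rel y x" unfolding angle_rel_def by blast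
  qed
  show "transp angle_rel"
  proof (rule transpI)
    fix x y z assume "angle_rel x y" "angle_rel y z"
    then obtain k l :: int where "x - y = 2 * pi * of_int k" "y - z = 2 * pi * of_int l"
      by (auto simp: angle_rel_def)
    then have "x - z = 2 * pi * of_int (k + l)" by (simp add: algebra_simps)
    then show "angle_rel x z" unfolding angle_rel_def by blast
  qed
qed

quotient_type angle = real / angle_rel
  by (rule equivp_angle_rel)

text \<open>The quotient topology; \<open>borel\<close> on \<^typ>\<open>angle\<close> is generated by it.\<close>

instantiation angle :: topological_space
begin

definition open_angle :: "angle set \<Rightarrow> bool" where
  "open_angle U \<longleftrightarrow> open (abs_angle -` U)"

instance
proof
  show "open (UNIV :: angle set)" by (simp add: open_angle_def)
next
  fix S T :: "angle set"
  assume "open S" "open T"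
  then show "open (S \<inter> T)" by (simp add: open_angle_def open_Int)
next
  fix K :: "angle set set"
  assume "\<forall>S\<in>K. open S"
  then show "open (\<Union>K)" unfolding open_angle_def vimage_Union by (intro open_UN) simp
qed

end

lift_definition phase :: "angle \<Rightarrow> complex" is "\<lambda>x. exp (- (\<i> * of_real x))"
proof -
  fix x y assume "angle_rel x y"
  then obtain k :: int where "x - y = 2 * pi * of_int k" by (auto simp: angle_rel_def)
  then have "x = y + 2 * pi * of_int k" by simp
  then have "- (\<i> * complex_of_real x) =
      - (\<i> * complex_of_real y) + of_real (of_int (2 * (- k)) * pi) * \<i>"
    by (simp add: algebra_simps)
  then show "exp (- (\<i> * complex_of_real x)) = exp (- (\<i> * complex_of_real y))"
    unfolding exp_eq by (rule exI)
qed

text \<open>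
  \<open>\<complex>\<^sup>2 \<otimes> l\<^sup>2(\<int>)\<close> is realised as the space \<open>l\<^sup>2(\<int>; \<complex>\<^sup>2)\<close> of square summable functions
  \<^typ>\<open>int \<Rightarrow> complex^2\<close>, where \<open>\<phi> \<otimes> f\<close> is the function \<open>k \<mapsto> f(k) \<phi>\<close>. Coordinates 1 and 2
  of \<^typ>\<open>complex^2\<close> are the coefficients of spin up and spin down. Operators are given on all
  functions; only their restriction to the space (for the position operator: to its
  domain) matters.
\<close>

type_synonym wavefun = "int \<Rightarrow> complex^2"

definition l2 :: "wavefun set" where
  "l2 = {\<psi>. (\<lambda>k. (norm (\<psi> k))\<^sup>2) summable_on UNIV}"

text \<open>Conjugate linear in the first argument.\<close>

definition l2_inner :: "wavefun \<Rightarrow> wavefun \<Rightarrow> complex" where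
  "l2_inner \<phi> \<psi> = (\<Sum>\<^sub>\<infinity>k. \<Sum>s\<in>UNIV. cnj (\<phi> k $ s) * \<psi> k $ s)"

definition l2_norm :: "wavefun \<Rightarrow> real" where
  "l2_norm \<psi> = sqrt (Re (l2_inner \<psi> \<psi>))"

text \<open>The Hilbert space adjoint; for existence and uniqueness see \<open>has_adjoint_evolution\<close>
  and \<open>is_adjoint_unique\<close> below.\<close>

definition is_adjoint :: "(wavefun \<Rightarrow> wavefun) \<Rightarrow> (wavefun \<Rightarrow> wavefun) \<Rightarrow> bool" where
  "is_adjoint A B \<longleftrightarrow> B ` l2 \<subseteq> l2 \<and>
     (\<forall>\<phi>\<in>l2. \<forall>\<psi>\<in>l2. l2_inner (B \<phi>) \<psi> = l2_inner \<phi> (A \<psi>))"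

definition adj :: "(wavefun \<Rightarrow> wavefun) \<Rightarrow> wavefun \<Rightarrow> wavefun" where
  "adj A = (SOME B. is_adjoint A B)"

definition ket :: "int \<Rightarrow> int \<Rightarrow> complex" where
  "ket k = (\<lambda>j. if j = k then 1 else 0)"

definition tensor :: "complex^2 \<Rightarrow> (int \<Rightarrow> complex) \<Rightarrow> wavefun" where
  "tensor \<phi> f = (\<lambda>k. f k *s \<phi>)"

definition tensor_ketbra :: "complex^2^2 \<Rightarrow> int \<Rightarrow> int \<Rightarrow> wavefun \<Rightarrow> wavefun" where
  "tensor_ketbra A j k \<psi> = tensor (A *v \<psi> k) (ket j)"

definition tensor_id :: "complex^2^2 \<Rightarrow> wavefun \<Rightarrow> wavefun" where
  "tensor_id A \<psi> = (\<lambda>k. A *v \<psi> k)"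

definition P_up :: "complex^2^2" where
  "P_up = vector [vector [1, 0], vector [0, 0]]"

definition P_down :: "complex^2^2" where
  "P_down = vector [vector [0, 0], vector [0, 1]]"

text \<open>At each site the sum has at most two nonzero terms.\<close>

definition shift :: "wavefun \<Rightarrow> wavefun" where
  "shift \<psi> = (\<lambda>j. \<Sum>\<^sub>\<infinity>k. tensor_ketbra P_up (k + 1) k \<psi> j + tensor_ketbra P_down (k - 1) k \<psi> j)"

definition coin :: "real \<Rightarrow> real \<Rightarrow> angle \<Rightarrow> angle \<Rightarrow> complex^2^2" where
  "coin r t a b = vector [vector [phase a * of_real t, - phase a * of_real r],
                          vector [phase b * of_real r, phase b * of_real t]]"

definition walk_step :: "real \<Rightarrow> real \<Rightarrow> angle \<Rightarrow> angle \<Rightarrow> wavefun \<Rightarrow> wavefun" where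
  "walk_step r t a b = shift \<circ> tensor_id (coin r t a b)"

text \<open>\<open>U(n,0) = U\<^sub>n \<cdots> U\<^sub>1\<close> for a realisation of the phases; the phases are indexed by time.\<close>

fun evolution :: "real \<Rightarrow> real \<Rightarrow> (int \<Rightarrow> angle) \<Rightarrow> (int \<Rightarrow> angle) \<Rightarrow> nat \<Rightarrow> wavefun \<Rightarrow> wavefun" where
  "evolution r t up down 0 = id"
| "evolution r t up down (Suc n) =
     walk_step r t (up (int (Suc n))) (down (int (Suc n))) \<circ> evolution r t up down n"

definition position :: "wavefun \<Rightarrow> wavefun" where
  "position \<psi> = (\<lambda>k. of_int k *s \<psi> k)"

definition position_moment ::
    "real \<Rightarrow> real \<Rightarrow> (int \<Rightarrow> angle) \<Rightarrow> (int \<Rightarrow> angle) \<Rightarrow> nat \<Rightarrow> wavefun \<Rightarrow> nat \<Rightarrow> complex" where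
  "position_moment r t up down L \<Psi> n =
     (let U = evolution r t up down n in l2_inner \<Psi> (adj U ((position ^^ L) (U \<Psi>))))"

text \<open>Only meaningful for \<open>r \<noteq> 0\<close>. The product is \<open>1 \<cdot> 3 \<cdots> (L - 1)\<close>, empty for \<open>L = 0\<close>.\<close>

definition limit_moment :: "real \<Rightarrow> real \<Rightarrow> nat \<Rightarrow> real" where
  "limit_moment r t L =
     (if odd L then 0 else (\<Prod>j | odd j \<and> j < L. real j) * (t\<^sup>2 / r\<^sup>2) ^ (L div 2))"

lemma norm_sq_C2: "(norm (v :: complex^2))\<^sup>2 = (cmod (v $ 1))\<^sup>2 + (cmod (v $ 2))\<^sup>2"
  by (simp add: norm_vec_def L2_set_def sum_2)

lemma l2_iff:
  "\<psi> \<in> l2 \<longleftrightarrow> (\<lambda>k. (cmod (\<psi> k $ 1))\<^sup>2) summable_on UNIV \<and> (\<lambda>k. (cmod (\<psi> k $ 2))\<^sup>2) summable_on UNIV"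
proof
  assume "\<psi> \<in> l2"
  then have *: "(\<lambda>k. (cmod (\<psi> k $ 1))\<^sup>2 + (cmod (\<psi> k $ 2))\<^sup>2) summable_on UNIV"
    by (simp add: l2_def norm_sq_C2)
  show "(\<lambda>k. (cmod (\<psi> k $ 1))\<^sup>2) summable_on UNIV \<and> (\<lambda>k. (cmod (\<psi> k $ 2))\<^sup>2) summable_on UNIV"
    by (auto intro: summable_on_comparison_test[OF *])
next
  assume "(\<lambda>k. (cmod (\<psi> k $ 1))\<^sup>2) summable_on UNIV \<and> (\<lambda>k. (cmod (\<psi> k $ 2))\<^sup>2) summable_on UNIV"
  then show "\<psi> \<in> l2" by (simp add: l2_def norm_sq_C2 summable_on_add)
qed

lemma summable_cnj_mult:
  fixes f g :: "int \<Rightarrow> complex"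
  assumes "(\<lambda>k. (cmod (f k))\<^sup>2) summable_on UNIV" "(\<lambda>k. (cmod (g k))\<^sup>2) summable_on UNIV"
  shows "(\<lambda>k. cnj (f k) * g k) summable_on UNIV"
proof -
  have "(\<lambda>k. norm (cnj (f k) * g k)) summable_on UNIV"
  proof (rule summable_on_comparison_test[OF summable_on_add[OF assms]])
    fix k :: int
    have "2 * (cmod (f k) * cmod (g k)) \<le> (cmod (f k))\<^sup>2 + (cmod (g k))\<^sup>2"
      using sum_squares_bound[of "cmod (f k)" "cmod (g k)"] by simp
    moreover have "0 \<le> cmod (f k) * cmod (g k)" by simp
    ultimately show "norm (cnj (f k) * g k) \<le> (cmod (f k))\<^sup>2 + (cmod (g k))\<^sup>2"
      by (simp only: norm_mult complex_mod_cnj)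
  qed simp
  then show ?thesis by (rule abs_summable_summable)
qed

lemma l2_inner_split:
  assumes "\<phi> \<in> l2" "\<psi> \<in> l2"
  shows "l2_inner \<phi> \<psi> = (\<Sum>\<^sub>\<infinity>k. cnj (\<phi> k $ 1) * \<psi> k $ 1) + (\<Sum>\<^sub>\<infinity>k. cnj (\<phi> k $ 2) * \<psi> k $ 2)"
  using assms by (simp add: l2_inner_def sum_2 l2_iff summable_cnj_mult infsum_add)

lemma shift_apply: "shift \<psi> j = P_up *v \<psi> (j - 1) + P_down *v \<psi> (j + 1)"
proof -
  have "shift \<psi> j = (\<Sum>\<^sub>\<infinity>k. (if k = j - 1 then P_up *v \<psi> k else 0) + (if k = j + 1 then P_down *v \<psi> k else 0))"
    unfolding shift_def
    by (intro infsum_cong) (auto simp: tensor_ketbra_def tensor_def ket_def)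
  also have "\<dots> = (\<Sum>\<^sub>\<infinity>k\<in>{j - 1, j + 1}.
      (if k = j - 1 then P_up *v \<psi> k else 0) + (if k = j + 1 then P_down *v \<psi> k else 0))"
    by (intro infsum_cong_neutral) auto
  also have "\<dots> = P_up *v \<psi> (j - 1) + P_down *v \<psi> (j + 1)"
    by simp
  finally show ?thesis .
qed

lemma shift_components: "shift \<psi> j $ 1 = \<psi> (j - 1) $ 1" "shift \<psi> j $ 2 = \<psi> (j + 1) $ 2"
  by (simp_all add: shift_apply P_up_def P_down_def matrix_vector_mult_def sum_2)

lemma bij_int_add: "bij_betw (\<lambda>k::int. k + a) UNIV UNIV"
  by (rule bij_betwI[where g = "\<lambda>k. k - a"]) auto

lemmas summable_shift = summable_on_reindex_bij_betw[OF bij_int_add]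
lemmas infsum_shift = infsum_reindex_bij_betw[OF bij_int_add]

lemma shift_l2: "\<psi> \<in> l2 \<Longrightarrow> shift \<psi> \<in> l2"
  using summable_shift[where a = "-1" and f = "\<lambda>k. (cmod (\<psi> k $ 1))\<^sup>2"]
        summable_shift[where a = 1 and f = "\<lambda>k. (cmod (\<psi> k $ 2))\<^sup>2"]
  by (simp add: l2_iff shift_components)

lemma tensor_id_l2:
  assumes "\<psi> \<in> l2" shows "tensor_id A \<psi> \<in> l2"
proof -
  have *: "(\<lambda>k. (cmod (a * \<psi> k $ 1 + b * \<psi> k $ 2))\<^sup>2) summable_on UNIV" for a b
  proof (rule summable_on_comparison_test)
    show "(\<lambda>k. 2 * (cmod a)\<^sup>2 * (cmod (\<psi> k $ 1))\<^sup>2 + 2 * (cmod b)\<^sup>2 * (cmod (\<psi> k $ 2))\<^sup>2) summable_on UNIV"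
      using assms by (intro summable_on_add summable_on_cmult_right) (auto simp: l2_iff)
    fix k
    let ?u = "cmod a * cmod (\<psi> k $ 1)" and ?v = "cmod b * cmod (\<psi> k $ 2)"
    have "(cmod (a * \<psi> k $ 1 + b * \<psi> k $ 2))\<^sup>2 \<le> (?u + ?v)\<^sup>2"
      using norm_triangle_ineq[of "a * \<psi> k $ 1" "b * \<psi> k $ 2"]
      by (intro power_mono) (simp_all add: norm_mult)
    also have "\<dots> \<le> 2 * ?u\<^sup>2 + 2 * ?v\<^sup>2"
      using sum_squares_bound[of ?u ?v] by (simp add: power2_sum)
    finally show "(cmod (a * \<psi> k $ 1 + b * \<psi> k $ 2))\<^sup>2
        \<le> 2 * (cmod a)\<^sup>2 * (cmod (\<psi> k $ 1))\<^sup>2 + 2 * (cmod b)\<^sup>2 * (cmod (\<psi> k $ 2))\<^sup>2"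
      by (simp add: power_mult_distrib)
  qed simp
  show ?thesis
    by (simp add: l2_iff tensor_id_def matrix_vector_mult_def sum_2 *)
qed

lemma is_adjoint_shift: "is_adjoint shift (\<lambda>\<psi> k. vector [\<psi> (k + 1) $ 1, \<psi> (k - 1) $ 2])"
proof -
  let ?B = "\<lambda>\<psi> k. vector [\<psi> (k + 1) $ 1, \<psi> (k - 1) $ 2] :: complex^2"
  have B: "?B \<psi> \<in> l2" if "\<psi> \<in> l2" for \<psi>
    using that summable_shift[where a = 1 and f = "\<lambda>k. (cmod (\<psi> k $ 1))\<^sup>2"]
          summable_shift[where a = "-1" and f = "\<lambda>k. (cmod (\<psi> k $ 2))\<^sup>2"]
    by (simp add: l2_iff)
  moreover have "l2_inner (?B \<phi>) \<psi> = l2_inner \<phi> (shift \<psi>)" if "\<phi> \<in> l2" "\<psi> \<in> l2" for \<phi> \<psi>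
    using infsum_shift[where a = 1 and f = "\<lambda>k. cnj (\<phi> k $ 1) * \<psi> (k - 1) $ 1"]
          infsum_shift[where a = "-1" and f = "\<lambda>k. cnj (\<phi> k $ 2) * \<psi> (k + 1) $ 2"]
    by (simp add: l2_inner_split B shift_l2 that shift_components)
  ultimately show ?thesis by (auto simp: is_adjoint_def)
qed

lemma is_adjoint_tensor_id: "is_adjoint (tensor_id A) (tensor_id (\<chi> i j. cnj (A $ j $ i)))"
  unfolding is_adjoint_def
proof (intro conjI ballI)
  show "tensor_id (\<chi> i j. cnj (A $ j $ i)) ` l2 \<subseteq> l2" by (auto simp: tensor_id_l2)
  fix \<phi> \<psi>
  show "l2_inner (tensor_id (\<chi> i j. cnj (A $ j $ i)) \<phi>) \<psi> = l2_inner \<phi> (tensor_id A \<psi>)"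
    unfolding l2_inner_def tensor_id_def
    by (intro infsum_cong) (simp add: matrix_vector_mult_def sum_2 algebra_simps)
qed

lemma is_adjoint_comp:
  assumes "is_adjoint A A'" "is_adjoint B B'" "B ` l2 \<subseteq> l2"
  shows "is_adjoint (A \<circ> B) (B' \<circ> A')"
  using assms unfolding is_adjoint_def by (auto simp: image_subset_iff)

lemma evolution_l2: "\<psi> \<in> l2 \<Longrightarrow> evolution r t up down n \<psi> \<in> l2"
  by (induction n) (auto simp: walk_step_def shift_l2 tensor_id_l2)

lemma is_adjoint_unique:
  assumes "is_adjoint A B" "is_adjoint A B'" "\<phi> \<in> l2"
  shows "B \<phi> = B' \<phi>"
proof -
  have *: "cnj (C \<phi> k $ s) = l2_inner \<phi> (A (tensor (axis s 1) (ket k)))" if "is_adjoint A C" for C k s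
  proof -
    let ?e = "tensor (axis s 1) (ket k)"
    have "(\<lambda>j. (norm (?e j))\<^sup>2) summable_on {k}" by simp
    then have "?e \<in> l2"
      unfolding l2_def mem_Collect_eq
      by (rule summable_on_cong_neutral[THEN iffD1, rotated -1]) (auto simp: tensor_def ket_def)
    then have "l2_inner \<phi> (A ?e) = l2_inner (C \<phi>) ?e"
      using that assms(3) by (simp add: is_adjoint_def)
    also have "\<dots> = (\<Sum>\<^sub>\<infinity>j. if j = k then cnj (C \<phi> k $ s) else 0)"
      unfolding l2_inner_def
      by (intro infsum_cong) (auto simp: tensor_def ket_def axis_def if_distrib cong: if_cong)
    also have "\<dots> = (\<Sum>\<^sub>\<infinity>j\<in>{k}. if j = k then cnj (C \<phi> k $ s) else 0)"
      by (intro infsum_cong_neutral) auto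
    also have "\<dots> = cnj (C \<phi> k $ s)" by simp
    finally show ?thesis by simp
  qed
  have "cnj (B \<phi> k $ s) = cnj (B' \<phi> k $ s)" for k s
    using *[OF assms(1)] *[OF assms(2)] by simp
  then show ?thesis by (intro ext) (simp add: vec_eq_iff)
qed

lemma has_adjoint_evolution: "\<exists>B. is_adjoint (evolution r t up down n) B"
proof (induction n)
  case 0
  show ?case by (auto simp: is_adjoint_def intro!: exI[of _ id])
next
  case (Suc n)
  then obtain B where B: "is_adjoint (evolution r t up down n) B" by blast
  have "\<exists>B. is_adjoint (walk_step r t a b) B" for a b
    unfolding walk_step_def
    using is_adjoint_comp[OF is_adjoint_shift is_adjoint_tensor_id] tensor_id_l2 by blast
  with is_adjoint_comp[OF _ B] evolution_l2 show ?case
    by (metis evolution.simps(2) image_subsetI)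
qed

end

theory Submission
  imports Defs "HOL-Real_Asymp.Real_Asymp"
begin

text \<open>
  The phases of the last step have mean zero and are independent of everything else, so the expected
  interference between the two spin components vanishes from time 1 on. Hence the
  averaged position distribution is that of a classical persistent random walk with steps
  \<open>s = \<plusminus>1\<close> of correlation \<open>\<rho> = t\<^sup>2 - r\<^sup>2\<close>. If \<open>X\<close> is its position, then \<open>Y = X + \<rho> / (1 - \<rho>) s\<close> is a
  martingale with bounded increments of constant conditional variance
  \<open>\<sigma>\<^sup>2 = (1 + \<rho>) / (1 - \<rho>) = t\<^sup>2 / r\<^sup>2\<close>. Expanding \<open>Y\<^sub>n\<^sub>+\<^sub>1\<close> binomially around \<open>Y\<^sub>n\<close>, the \<open>m\<close>-th moment
  grows in one step by \<open>m (m - 1) / 2 \<sigma>\<^sup>2\<close> times the moment of order \<open>m - 2\<close>, up to moments of lower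
  order. By the Stolz-Cesaro theorem the limits satisfy the recursion
  \<open>D m = (m - 1) \<sigma>\<^sup>2 D (m - 2)\<close> of the Gaussian moments, and the bounded difference \<open>X - Y\<close> does
  not affect them.
\<close>

subsection \<open>Growth of sequences\<close>

text \<open>Past some \<open>N\<close> the increments of \<open>a - l * b\<close> are at most
  \<open>e / 2\<close> times those of \<open>b\<close>. Telescoping leaves an error of
  \<open>e / 2 * b n\<close> plus a constant, which \<open>b n\<close> outgrows.\<close>

lemma stolz_cesaro:
  fixes a b :: "nat \<Rightarrow> real"
  assumes "strict_mono b" "filterlim b at_top sequentially"
    and "(\<lambda>n. (a (Suc n) - a n) / (b (Suc n) - b n)) \<longlonglongrightarrow> l"
  shows "(\<lambda>n. a n / b n) \<longlonglongrightarrow> l"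
proof (rule LIMSEQ_I)
  fix e :: real assume "0 < e"
  then obtain N where N: "\<bar>(a (Suc n) - a n) / (b (Suc n) - b n) - l\<bar> < e / 2" if "n \<ge> N" for n
    using LIMSEQ_D[OF assms(3), of "e / 2"] by auto
  have step_le: "\<bar>(a (Suc n) - l * b (Suc n)) - (a n - l * b n)\<bar> \<le> e / 2 * (b (Suc n) - b n)"
    if "n \<ge> N" for n
  proof -
    have "b n < b (Suc n)" using assms(1) by (simp add: strict_mono_def)
    moreover have "(a (Suc n) - l * b (Suc n)) - (a n - l * b n)
        = ((a (Suc n) - a n) / (b (Suc n) - b n) - l) * (b (Suc n) - b n)"
      using calculation by (simp add: field_simps)
    ultimately show ?thesis
      using N[OF that] by (simp add: abs_mult)
  qed
  have tele: "\<bar>(a n - l * b n) - (a N - l * b N)\<bar> \<le> e / 2 * (b n - b N)" if "n \<ge> N" for n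
    using that
  proof (induction n rule: dec_induct)
    case (step n)
    then show ?case using step_le[OF step.hyps(1)] by (simp only: right_diff_distrib)
  qed simp
  have "(\<lambda>n. (\<bar>a N - l * b N\<bar> + e / 2 * \<bar>b N\<bar>) / b n) \<longlonglongrightarrow> 0"
    by (rule tendsto_divide_0[OF tendsto_const filterlim_at_top_imp_at_infinity[OF assms(2)]])
  then have "\<forall>\<^sub>F n in sequentially. (\<bar>a N - l * b N\<bar> + e / 2 * \<bar>b N\<bar>) / b n < e / 2"
    using \<open>0 < e\<close> by (intro order_tendstoD) auto
  moreover have "\<forall>\<^sub>F n in sequentially. b n > 0"
    using assms(2) by (simp add: filterlim_at_top_dense)
  ultimately have "\<forall>\<^sub>F n in sequentially. norm (a n / b n - l) < e"
    using eventually_ge_at_top[of N]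
  proof eventually_elim
    case (elim n)
    have "\<bar>a n - l * b n\<bar> \<le> \<bar>a N - l * b N\<bar> + e / 2 * (b n - b N)"
      using tele[OF elim(3)] by linarith
    also have "\<dots> \<le> (\<bar>a N - l * b N\<bar> + e / 2 * \<bar>b N\<bar>) + e / 2 * b n"
    proof -
      have "e / 2 * (- b N) \<le> e / 2 * \<bar>b N\<bar>" using \<open>0 < e\<close> by (intro mult_left_mono) auto
      then show ?thesis by (simp add: algebra_simps)
    qed
    also have "\<dots> < e / 2 * b n + e / 2 * b n"
      using elim by (simp add: field_simps)
    finally have "\<bar>a n - l * b n\<bar> < e * b n" by simp
    moreover have "a n / b n - l = (a n - l * b n) / b n" using elim by (simp add: field_simps)
    ultimately show ?case using elim by (simp add: field_simps)
  qed
  then show "\<exists>no. \<forall>n\<ge>no. norm (a n / b n - l) < e"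
    by (simp add: eventually_sequentially)
qed

text \<open>Stolz-Cesaro applies because the increments of \<open>n powr (\<alpha> + 1)\<close> are
  asymptotic to \<open>(\<alpha> + 1) * n powr \<alpha>\<close>.\<close>

lemma tendsto_powr_of_increments:
  fixes a :: "nat \<Rightarrow> real" and \<alpha> l :: real
  assumes "\<alpha> \<ge> 0" "(\<lambda>n. (a (Suc n) - a n) / real n powr \<alpha>) \<longlonglongrightarrow> l"
  shows "(\<lambda>n. a n / real n powr (\<alpha> + 1)) \<longlonglongrightarrow> l / (\<alpha> + 1)"
proof (rule stolz_cesaro)
  let ?b = "\<lambda>n. real n powr (\<alpha> + 1)"
  show "strict_mono ?b"
    using assms(1) by (intro strict_monoI powr_less_mono2) auto
  show "filterlim ?b at_top sequentially"
    using assms(1) by real_asymp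
  have "(\<lambda>n. real n powr \<alpha> / (?b (Suc n) - ?b n)) \<longlonglongrightarrow> inverse (\<alpha> + 1)"
    using assms(1) by real_asymp
  from tendsto_mult[OF assms(2) this]
  have "(\<lambda>n. (a (Suc n) - a n) / real n powr \<alpha> * (real n powr \<alpha> / (?b (Suc n) - ?b n)))
      \<longlonglongrightarrow> l / (\<alpha> + 1)" by (simp add: divide_inverse)
  \<comment> \<open>The factor \<open>real n powr \<alpha>\<close> is 0 at \<open>n = 0\<close>, so
    it cancels only from \<open>n = 1\<close> on.\<close>
  then show "(\<lambda>n. (a (Suc n) - a n) / (?b (Suc n) - ?b n)) \<longlonglongrightarrow> l / (\<alpha> + 1)"
    by (rule Lim_transform_eventually) (auto simp: eventually_sequentially intro!: exI[of _ 1])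
qed

subsection \<open>Moments of the persistent random walk\<close>

text \<open>
  Test functions \<open>g x s\<close> depend on the position \<open>x\<close> and the last step \<open>s = \<plusminus>1\<close> of a persistent walk,
  which repeats its last step with probability \<open>(1 + \<rho>) / 2\<close>. Working with the transition operator
  on test functions avoids the construction of the Markov chain. Time 0 is the moment after the
  first step, which is up with probability \<open>p\<close>.
\<close>

definition walk_op :: "real \<Rightarrow> (real \<Rightarrow> real \<Rightarrow> real) \<Rightarrow> real \<Rightarrow> real \<Rightarrow> real" where
  "walk_op \<rho> g x s = (1 + \<rho> * s) / 2 * g (x + 1) 1 + (1 - \<rho> * s) / 2 * g (x - 1) (-1)"

definition walk_expect :: "real \<Rightarrow> real \<Rightarrow> nat \<Rightarrow> (real \<Rightarrow> real \<Rightarrow> real) \<Rightarrow> real" where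
  "walk_expect p \<rho> n g = p * (walk_op \<rho> ^^ n) g 1 1 + (1 - p) * (walk_op \<rho> ^^ n) g (-1) (-1)"

locale persistent_walk =
  fixes p \<rho> :: real
  assumes p: "0 \<le> p" "p \<le> 1" and rho: "-1 \<le> \<rho>" "\<rho> < 1"
begin

abbreviation "T \<equiv> walk_op \<rho>"
abbreviation "E \<equiv> walk_expect p \<rho>"

section \<open>Linearity and monotonicity of the walk expectation\<close>

lemma E_0: "E 0 g = p * g 1 1 + (1 - p) * g (-1) (-1)"
  by (simp add: walk_expect_def)

text \<open>Conditioning on the state at time \<open>n\<close>: the innermost \<open>T\<close>
  averages over the last step. Inductions on \<open>n\<close> with an arbitrary test function rest
  on this.\<close>

lemma E_Suc: "E (Suc n) g = E n (T g)"
  by (simp add: walk_expect_def funpow_Suc_right del: funpow.simps)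

text \<open>\<open>T\<close> evaluates its argument only at the steps 1 and -1, and from such steps
  its weights are nonnegative because \<open>\<rho>\<close> lies between -1 and 1.\<close>

lemma E_mono:
  "(\<And>x s. s \<in> {1, -1} \<Longrightarrow> g x s \<le> h x s) \<Longrightarrow> E n g \<le> E n h"
proof (induction n arbitrary: g h)
  case 0
  then show ?case using p by (auto simp: E_0 intro!: add_mono mult_left_mono)
next
  case (Suc n)
  show ?case unfolding E_Suc
    by (rule Suc.IH) (use rho Suc.prems in \<open>auto simp: walk_op_def intro!: add_mono mult_left_mono\<close>)
qed

lemma E_cong:
  "(\<And>x s. s \<in> {1, -1} \<Longrightarrow> g x s = h x s) \<Longrightarrow> E n g = E n h"
  by (intro antisym E_mono) auto

lemma E_add: "E n (\<lambda>x s. g x s + h x s) = E n g + E n h"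
proof (induction n arbitrary: g h)
  case (Suc n)
  have "T (\<lambda>x s. g x s + h x s) = (\<lambda>x s. T g x s + T h x s)"
    by (simp add: walk_op_def fun_eq_iff algebra_simps)
  with Suc show ?case by (simp add: E_Suc)
qed (simp add: E_0 algebra_simps)

lemma E_cmult: "E n (\<lambda>x s. c * g x s) = c * E n g"
proof (induction n arbitrary: g)
  case (Suc n)
  have "T (\<lambda>x s. c * g x s) = (\<lambda>x s. c * T g x s)"
    by (simp add: walk_op_def fun_eq_iff algebra_simps)
  with Suc show ?case by (simp add: E_Suc)
qed (simp add: E_0 algebra_simps)

lemma E_const: "E n (\<lambda>x s. c) = c"
proof (induction n)
  case (Suc n)
  have "T (\<lambda>x s. c) = (\<lambda>x s. c)"
    by (simp add: walk_op_def fun_eq_iff field_simps)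
  with Suc show ?case by (simp add: E_Suc)
qed (simp add: E_0 algebra_simps)

lemma E_sum: "finite J \<Longrightarrow> E n (\<lambda>x s. \<Sum>j\<in>J. g j x s) = (\<Sum>j\<in>J. E n (g j))"
  by (induction J rule: finite_induct) (simp_all add: E_add E_const)

lemma E_abs_le: "\<bar>E n g\<bar> \<le> E n (\<lambda>x s. \<bar>g x s\<bar>)"
  using E_mono[of g "\<lambda>x s. \<bar>g x s\<bar>" n] E_mono[of "\<lambda>x s. - 1 * g x s" "\<lambda>x s. \<bar>g x s\<bar>" n]
  unfolding E_cmult by (simp add: abs_le_iff)

text \<open>
  The increments of this martingale have the constant conditional variance \<open>(1 + \<rho>) / (1 - \<rho>)\<close>
 , so that no mixing of the chain of steps is needed and \<open>\<rho> = -1\<close>, which is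
  \<open>t = 0\<close>, is not exceptional.
\<close>

definition "mart x s = x + \<rho> / (1 - \<rho>) * s"

text \<open>When the step \<open>s'\<close> follows \<open>s\<close>, \<open>mart\<close> grows by
  \<open>s' + \<rho> / (1 - \<rho>) * (s' - s)\<close>, which simplifies to this quotient.\<close>

definition "incr s' s = (s' - \<rho> * s) / (1 - \<rho>)"

text \<open>The conditional expectation of \<open>incr s' s ^ j\<close> over the next step
  \<open>s'\<close>, given the last step \<open>s\<close>.\<close>

definition "incr_moment j s = (1 + \<rho> * s) / 2 * incr 1 s ^ j + (1 - \<rho> * s) / 2 * incr (-1) s ^ j"

definition "moment m n = E n (\<lambda>x s. mart x s ^ m)"

definition "abs_moment m n = E n (\<lambda>x s. \<bar>mart x s\<bar> ^ m)"

section \<open>Conditional moments of the increments and the moment recursion\<close>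

lemma abs_incr_moment_le:
  assumes "s \<in> {1, -1}"
  shows "\<bar>incr_moment j s\<bar> \<le> (2 / (1 - \<rho>)) ^ j"
proof -
  have *: "\<bar>incr s' s\<bar> ^ j \<le> (2 / (1 - \<rho>)) ^ j" if "s' \<in> {1, -1}" for s'
    unfolding incr_def using that assms rho
    by (intro power_mono) (auto simp: abs_le_iff divide_simps)
  have "\<bar>incr_moment j s\<bar> \<le> \<bar>(1 + \<rho> * s) / 2 * incr 1 s ^ j\<bar> + \<bar>(1 - \<rho> * s) / 2 * incr (-1) s ^ j\<bar>"
    unfolding incr_moment_def by (rule abs_triangle_ineq)
  also have "\<dots> = (1 + \<rho> * s) / 2 * \<bar>incr 1 s\<bar> ^ j + (1 - \<rho> * s) / 2 * \<bar>incr (-1) s\<bar> ^ j"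
    using assms rho by (auto simp: abs_mult power_abs)
  also have "\<dots> \<le> (1 + \<rho> * s) / 2 * (2 / (1 - \<rho>)) ^ j + (1 - \<rho> * s) / 2 * (2 / (1 - \<rho>)) ^ j"
    using assms rho by (intro add_mono mult_left_mono *) auto
  also have "\<dots> = (2 / (1 - \<rho>)) ^ j"
    unfolding distrib_right[symmetric] add_divide_distrib[symmetric] by simp
  finally show ?thesis .
qed

lemma incr_moment_0: "incr_moment 0 s = 1"
  by (simp add: incr_moment_def field_simps)

text \<open>The martingale property: the next step has conditional mean
  \<open>\<rho> * s\<close>.\<close>

lemma incr_moment_1: "incr_moment (Suc 0) s = 0"
  using rho by (simp add: incr_moment_def incr_def divide_simps) (simp add: algebra_simps)

text \<open>As \<open>s\<close> squares to 1, the next step has conditional variance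
  \<open>(1 - \<rho>) * (1 + \<rho>)\<close> whatever \<open>s\<close> is, and \<open>incr\<close>
  divides the centred step by \<open>1 - \<rho>\<close>.\<close>

lemma incr_moment_2:
  assumes "s \<in> {1, -1}"
  shows "incr_moment 2 s = (1 + \<rho>) / (1 - \<rho>)"
  using rho assms
  by (auto simp: incr_moment_def incr_def divide_simps) (auto simp: power2_eq_square algebra_simps)

text \<open>A step adds \<open>incr\<close> to \<open>mart\<close>. Averaging the binomial expansion
  over both possible steps turns the powers of \<open>incr\<close> into
  \<open>incr_moment\<close>.\<close>

lemma T_mart_power:
  "T (\<lambda>x s. mart x s ^ m) x s = (\<Sum>j\<le>m. real (m choose j) * (incr_moment j s * mart x s ^ (m - j)))"
proof -
  have "mart (x + 1) 1 = incr 1 s + mart x s" "mart (x - 1) (-1) = incr (-1) s + mart x s"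
  proof -
    have "1 + \<rho> / (1 - \<rho>) = 1 / (1 - \<rho>)" "-1 - \<rho> / (1 - \<rho>) = - 1 / (1 - \<rho>)"
      using rho by (simp_all add: divide_simps)
    then show "mart (x + 1) 1 = incr 1 s + mart x s" "mart (x - 1) (-1) = incr (-1) s + mart x s"
      by (simp_all add: mart_def incr_def diff_divide_distrib)
  qed
  then have "T (\<lambda>x s. mart x s ^ m) x s =
      (1 + \<rho> * s) / 2 * (incr 1 s + mart x s) ^ m + (1 - \<rho> * s) / 2 * (incr (-1) s + mart x s) ^ m"
    by (simp only: walk_op_def)
  then show ?thesis
    unfolding binomial_ring incr_moment_def sum_distrib_left sum.distrib[symmetric]
    by (simp add: algebra_simps)
qed

text \<open>The weights \<open>w\<close> will be \<open>incr_moment j\<close> and, on returning from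
  \<open>mart\<close> to the position, powers of a multiple of \<open>s\<close>. Only their
  boundedness matters.\<close>

lemma E_weighted_le:
  assumes "\<And>s. s \<in> {1, -1} \<Longrightarrow> \<bar>w s\<bar> \<le> W"
  shows "\<bar>E n (\<lambda>x s. w s * mart x s ^ m)\<bar> \<le> W * abs_moment m n"
proof -
  have "\<bar>E n (\<lambda>x s. w s * mart x s ^ m)\<bar> \<le> E n (\<lambda>x s. \<bar>w s * mart x s ^ m\<bar>)"
    by (rule E_abs_le)
  also have "\<dots> \<le> E n (\<lambda>x s. W * \<bar>mart x s\<bar> ^ m)"
    by (rule E_mono) (use assms in \<open>auto simp: abs_mult power_abs intro!: mult_right_mono\<close>)
  finally show ?thesis by (simp add: E_cmult abs_moment_def)
qed

lemma moment_Suc: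
  "moment m (Suc n) = (\<Sum>j\<le>m. real (m choose j) * E n (\<lambda>x s. incr_moment j s * mart x s ^ (m - j)))"
proof -
  have "T (\<lambda>x s. mart x s ^ m) =
      (\<lambda>x s. \<Sum>j\<le>m. real (m choose j) * (incr_moment j s * mart x s ^ (m - j)))"
    by (simp add: fun_eq_iff T_mart_power)
  then show ?thesis
    unfolding moment_def E_Suc by (simp add: E_sum E_cmult)
qed

text \<open>The term \<open>j = 0\<close> is the old moment, and the term \<open>j = 1\<close>
  vanishes by the martingale property.\<close>

lemma moment_Suc_eq:
  assumes "m \<ge> 2"
  shows "moment m (Suc n) = moment m n + (\<Sum>j=2..m. real (m choose j) * E n (\<lambda>x s. incr_moment j s * mart x s ^ (m - j)))"
proof -
  have "{..m} = insert 0 (insert (Suc 0) {2..m})" using assms by auto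
  then show ?thesis
    by (simp add: moment_Suc incr_moment_0 incr_moment_1 E_const) (simp add: moment_def)
qed

text \<open>The weight of the term \<open>j = 2\<close> is constant, so this term is an exact
  multiple of a moment. The remaining ones have order at most \<open>m - 3\<close>.\<close>

lemma moment_Suc_diff:
  assumes "m \<ge> 2"
  shows "moment m (Suc n) - moment m n = real (m choose 2) * ((1 + \<rho>) / (1 - \<rho>)) * moment (m - 2) n
    + (\<Sum>j=3..m. real (m choose j) * E n (\<lambda>x s. incr_moment j s * mart x s ^ (m - j)))"
proof -
  have "{2..m} = insert 2 {3..m}" using assms by auto
  moreover have "E n (\<lambda>x s. incr_moment 2 s * mart x s ^ (m - 2)) =
      (1 + \<rho>) / (1 - \<rho>) * moment (m - 2) n"
    unfolding moment_def E_cmult[symmetric] by (rule E_cong) (simp add: incr_moment_2)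
  ultimately show ?thesis
    using moment_Suc_eq[OF assms, of n] by simp
qed

section \<open>Growth bounds for the moments\<close>

lemma abs_moment_le:
  assumes "k \<le> 2 * q"
  shows "abs_moment k n \<le> 1 + moment (2 * q) n"
proof -
  have "\<bar>y\<bar> ^ k \<le> 1 + y ^ (2 * q)" for y :: real
  proof (cases "\<bar>y\<bar> \<le> 1")
    case True
    then have "\<bar>y\<bar> ^ k \<le> 1" by (simp add: power_le_one)
    moreover have "0 \<le> y ^ (2 * q)" by (simp add: power_mult)
    ultimately show ?thesis by linarith
  next
    case False
    then have "\<bar>y\<bar> ^ k \<le> \<bar>y\<bar> ^ (2 * q)" using assms by (intro power_increasing) auto
    also have "\<dots> = y ^ (2 * q)" by (simp add: power_mult)
    finally show ?thesis by simp
  qed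
  then have "abs_moment k n \<le> E n (\<lambda>x s. 1 + mart x s ^ (2 * q))"
    unfolding abs_moment_def by (intro E_mono)
  then show ?thesis by (simp add: E_add E_const moment_def)
qed

lemma abs_moment_nonneg: "0 \<le> abs_moment m n"
  using E_mono[of "\<lambda>x s. 0" "\<lambda>x s. \<bar>mart x s\<bar> ^ m" n] by (simp add: abs_moment_def E_const)

text \<open>Induction on \<open>q\<close>: the orders \<open>m - j\<close> with
  \<open>j \<ge> 2\<close> are at most \<open>2 * q\<close>, so each step adds at most a multiple of
  \<open>real (Suc n) ^ q\<close>. Summing over the steps gains one power.\<close>

lemma even_moment_bound: "\<exists>K\<ge>0. \<forall>n. moment (2 * q) n \<le> K * real (Suc n) ^ q"
proof (induction q)
  case 0
  show ?case by (auto simp: moment_def E_const intro!: exI[of _ 1])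
next
  case (Suc q)
  then obtain K where K: "K \<ge> 0" "\<And>n. moment (2 * q) n \<le> K * real (Suc n) ^ q" by blast
  define m where "m = 2 * Suc q"
  define B where "B = (\<Sum>j=2..m. real (m choose j) * (2 / (1 - \<rho>)) ^ j)"
  have B: "B \<ge> 0" unfolding B_def using rho by (intro sum_nonneg mult_nonneg_nonneg zero_le_power) auto
  have step: "moment m (Suc n) \<le> moment m n + B * (1 + K) * real (Suc n) ^ q" for n
  proof -
    have "(\<Sum>j=2..m. real (m choose j) * E n (\<lambda>x s. incr_moment j s * mart x s ^ (m - j)))
        \<le> (\<Sum>j=2..m. real (m choose j) * ((2 / (1 - \<rho>)) ^ j * (1 + moment (2 * q) n)))"
    proof (intro sum_mono mult_left_mono)
      fix j assume j: "j \<in> {2..m}"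
      have "E n (\<lambda>x s. incr_moment j s * mart x s ^ (m - j)) \<le> (2 / (1 - \<rho>)) ^ j * abs_moment (m - j) n"
        using E_weighted_le[of "incr_moment j" "(2 / (1 - \<rho>)) ^ j" n "m - j"] abs_incr_moment_le
        by (simp add: abs_le_iff)
      also have "\<dots> \<le> (2 / (1 - \<rho>)) ^ j * (1 + moment (2 * q) n)"
        using j rho by (intro mult_left_mono abs_moment_le) (auto simp: m_def)
      finally show "E n (\<lambda>x s. incr_moment j s * mart x s ^ (m - j))
          \<le> (2 / (1 - \<rho>)) ^ j * (1 + moment (2 * q) n)" .
    qed auto
    also have "\<dots> = B * (1 + moment (2 * q) n)"
      by (simp add: B_def sum_distrib_right mult.assoc)
    also have "\<dots> \<le> B * ((1 + K) * real (Suc n) ^ q)"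
    proof (rule mult_left_mono[OF _ B])
      have "1 \<le> real (Suc n) ^ q" by (rule one_le_power) simp
      then show "1 + moment (2 * q) n \<le> (1 + K) * real (Suc n) ^ q"
        using K(2)[of n] unfolding distrib_right by linarith
    qed
    finally show ?thesis by (subst moment_Suc_eq) (simp_all add: m_def mult.assoc)
  qed
  \<comment> \<open>\<open>K'\<close> dominates both the initial moment and the constant of one
    step. The induction closes because
    \<open>Suc n ^ Suc q + Suc n ^ q = Suc (Suc n) * Suc n ^ q\<close>.\<close>
  define K' where "K' = \<bar>moment m 0\<bar> + B * (1 + K)"
  have "moment m n \<le> K' * real (Suc n) ^ Suc q" for n
  proof (induction n)
    case 0
    have "0 \<le> B * (1 + K)" using B K(1) by (intro mult_nonneg_nonneg) auto
    then have "moment m 0 \<le> K'" unfolding K'_def by linarith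
    then show ?case by simp
  next
    case (Suc n)
    have "moment m (Suc n) \<le> K' * real (Suc n) ^ Suc q + B * (1 + K) * real (Suc n) ^ q"
      using step[of n] Suc by linarith
    also have "\<dots> \<le> K' * real (Suc n) ^ Suc q + K' * real (Suc n) ^ q"
      by (simp add: K'_def mult_right_mono)
    also have "\<dots> = K' * (real (Suc (Suc n)) * real (Suc n) ^ q)"
      by (simp add: algebra_simps)
    also have "\<dots> \<le> K' * (real (Suc (Suc n)) * real (Suc (Suc n)) ^ q)"
      using B K(1) by (intro mult_left_mono power_mono) (auto simp: K'_def)
    finally show ?case by simp
  qed
  moreover have "K' \<ge> 0" using B K(1) by (simp add: K'_def)
  ultimately show ?case unfolding m_def by blast
qed

text \<open>In place of Cauchy-Schwarz, \<open>z \<le> a + 1 / a * (z * z)\<close> with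
  \<open>z = \<bar>y\<bar> ^ m\<close> passes to the even order \<open>2 * m\<close>. The chosen
  \<open>a\<close> balances both terms, since the moment of order \<open>2 * m\<close> is at most a
  multiple of \<open>a * a\<close>.\<close>

lemma abs_moment_bound: "\<exists>K. \<forall>n. abs_moment m n \<le> K * real (Suc n) powr (real m / 2)"
proof -
  obtain K where K: "\<And>n. moment (2 * m) n \<le> K * real (Suc n) ^ m"
    using even_moment_bound by blast
  have "abs_moment m n \<le> (1 + K) * real (Suc n) powr (real m / 2)" for n
  proof -
    define a where "a = real (Suc n) powr (real m / 2)"
    have a: "a > 0" "real (Suc n) ^ m = a * a"
      by (simp_all add: a_def powr_add[symmetric] powr_realpow)
    have "\<bar>y\<bar> ^ m \<le> a + 1 / a * y ^ (2 * m)" for y :: real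
    proof -
      have "y ^ (2 * m) = \<bar>y\<bar> ^ m * \<bar>y\<bar> ^ m"
        by (simp add: power_mult power2_eq_square flip: power_mult_distrib)
      moreover have "z \<le> a + 1 / a * (z * z)" if "z \<ge> 0" for z
      proof -
        have "0 \<le> (a - z)\<^sup>2" "0 \<le> a * z" using a that by simp_all
        then have "z * a \<le> a * a + z * z" by (simp add: power2_eq_square algebra_simps)
        then show ?thesis using a by (simp add: field_simps)
      qed
      ultimately show ?thesis by simp
    qed
    then have "abs_moment m n \<le> E n (\<lambda>x s. a + 1 / a * mart x s ^ (2 * m))"
      unfolding abs_moment_def by (intro E_mono)
    also have "\<dots> = a + 1 / a * moment (2 * m) n"
      unfolding E_add E_const E_cmult moment_def ..
    also have "\<dots> \<le> a + 1 / a * (K * (a * a))"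
      using K[of n] a by (intro add_left_mono mult_left_mono) auto
    also have "\<dots> = (1 + K) * a" using a by (simp add: field_simps)
    finally show ?thesis by (simp add: a_def)
  qed
  then show ?thesis by blast
qed

lemma abs_moment_negligible:
  assumes "\<alpha> > real m / 2"
  shows "(\<lambda>n. abs_moment m n / real n powr \<alpha>) \<longlonglongrightarrow> 0"
proof -
  obtain K where K: "\<And>n. abs_moment m n \<le> K * real (Suc n) powr (real m / 2)"
    using abs_moment_bound by blast
  show ?thesis
  proof (rule tendsto_sandwich)
    show "\<forall>\<^sub>F n in sequentially. 0 \<le> abs_moment m n / real n powr \<alpha>"
      by (simp add: abs_moment_nonneg)
    show "\<forall>\<^sub>F n in sequentially. abs_moment m n / real n powr \<alpha>
        \<le> K * (real (Suc n) powr (real m / 2) / real n powr \<alpha>)"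
      using K by (intro always_eventually allI) (simp add: divide_right_mono)
    define \<beta> where "\<beta> = real m / 2"
    have "\<alpha> > \<beta>" using assms by (simp add: \<beta>_def)
    then have "(\<lambda>n. real (Suc n) powr \<beta> / real n powr \<alpha>) \<longlonglongrightarrow> 0"
      by real_asymp
    from tendsto_mult_left[OF this, of K]
    show "(\<lambda>n. K * (real (Suc n) powr (real m / 2) / real n powr \<alpha>)) \<longlonglongrightarrow> 0"
      by (simp add: \<beta>_def)
  qed simp
qed

lemma weighted_negligible:
  assumes "\<alpha> > real m / 2" "\<And>s. s \<in> {1, -1} \<Longrightarrow> \<bar>w s\<bar> \<le> W"
  shows "(\<lambda>n. E n (\<lambda>x s. w s * mart x s ^ m) / real n powr \<alpha>) \<longlonglongrightarrow> 0"
proof (rule Lim_null_comparison)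
  show "\<forall>\<^sub>F n in sequentially. norm (E n (\<lambda>x s. w s * mart x s ^ m) / real n powr \<alpha>)
      \<le> W * (abs_moment m n / real n powr \<alpha>)"
    using E_weighted_le[of w W, OF assms(2)] by (simp add: divide_right_mono)
  show "(\<lambda>n. W * (abs_moment m n / real n powr \<alpha>)) \<longlonglongrightarrow> 0"
    using tendsto_mult_left[OF abs_moment_negligible[OF assms(1)], of W] by simp
qed

section \<open>Convergence to the Gaussian moments\<close>

text \<open>The \<open>m\<close>-th moment of the centred normal law of variance
  \<open>(1 + \<rho>) / (1 - \<rho>)\<close>; for \<open>\<rho> = -1\<close> that law is a point
  mass at 0.\<close>

definition "gauss m = (if odd m then 0 else (\<Prod>j | odd j \<and> j < m. real j) * ((1 + \<rho>) / (1 - \<rho>)) ^ (m div 2))"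

lemma gauss_rec: "gauss (Suc (Suc m)) = real (Suc m) * ((1 + \<rho>) / (1 - \<rho>)) * gauss m"
proof (cases "odd m")
  case False
  then have "{j. odd j \<and> j < Suc (Suc m)} = insert (Suc m) {j. odd j \<and> j < m}"
    by (auto simp: less_Suc_eq)
  with False show ?thesis by (simp add: gauss_def)
qed (simp add: gauss_def)

text \<open>For \<open>m = k + 2\<close>, the increment divided by \<open>n powr (k / 2)\<close>
  keeps only its \<open>j = 2\<close> term in the limit, as the others have order below
  \<open>k\<close>. Stolz-Cesaro then divides by \<open>k / 2 + 1\<close>, and
  \<open>m choose 2\<close> over this is \<open>k + 1\<close>, the factor in
  \<open>gauss_rec\<close>.\<close>

lemma moment_limit: "(\<lambda>n. moment m n / real n powr (real m / 2)) \<longlonglongrightarrow> gauss m"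
proof (induction m rule: less_induct)
  case (less m)
  consider "m = 0" | "m = 1" | k where "m = Suc (Suc k)"
    by (metis One_nat_def not0_implies_Suc)
  then show ?case
  proof cases
    case 1
    \<comment> \<open>The equality starts at \<open>n = 1\<close>, because
      \<open>0 powr 0 = 0\<close>.\<close>
    then have "\<forall>\<^sub>F n in sequentially. 1 = moment m n / real n powr (real m / 2)"
      by (auto simp: moment_def E_const eventually_sequentially intro!: exI[of _ 1])
    moreover have "gauss m = 1" using 1 by (simp add: gauss_def)
    ultimately show ?thesis by (auto intro: Lim_transform_eventually[OF tendsto_const])
  next
    case 2
    define c where "c = moment 1 0"
    have "moment 1 n = c" for n
    proof (induction n)
      case (Suc n)
      have "moment 1 (Suc n) = moment 1 n"
        using moment_Suc[of "Suc 0" n]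
        by (simp add: incr_moment_0 incr_moment_1 E_const) (simp add: moment_def)
      with Suc show ?case by simp
    qed (simp add: c_def)
    moreover have "(\<lambda>n. c / real n powr (1 / 2)) \<longlonglongrightarrow> 0"
      by real_asymp
    ultimately show ?thesis using 2 by (simp add: gauss_def)
  next
    case 3
    define v where "v = (1 + \<rho>) / (1 - \<rho>)"
    have lim: "(\<lambda>n. real (m choose 2) * v * (moment k n / real n powr (real k / 2))
        + (\<Sum>j=3..m. real (m choose j) *
            (E n (\<lambda>x s. incr_moment j s * mart x s ^ (m - j)) / real n powr (real k / 2))))
        \<longlonglongrightarrow> real (m choose 2) * v * gauss k + (\<Sum>j=3..m. real (m choose j) * 0)"
    proof (intro tendsto_intros less.IH weighted_negligible[OF _ abs_incr_moment_le])
      fix j assume "j \<in> {3..m}"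
      then show "real (m - j) / 2 < real k / 2" using 3 by auto
    qed (use 3 in auto)
    have "(\<lambda>n. moment m n / real n powr (real k / 2 + 1))
        \<longlonglongrightarrow> real (m choose 2) * v * gauss k / (real k / 2 + 1)"
    proof (rule tendsto_powr_of_increments)
      show "(\<lambda>n. (moment m (Suc n) - moment m n) / real n powr (real k / 2))
          \<longlonglongrightarrow> real (m choose 2) * v * gauss k"
      proof -
        have "2 \<le> m" "m - 2 = k" using 3 by auto
        then show ?thesis
          using lim by (simp add: moment_Suc_diff v_def add_divide_distrib sum_divide_distrib)
      qed
    qed simp
    moreover have "real (m choose 2) / (real k / 2 + 1) = real (Suc k)"
    proof -
      have "real (2 * (m choose 2)) = real (m * (m - 1))"
        by (simp only: choose_two) (use 3 in auto)
      then show ?thesis using 3 by (simp add: field_simps)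
    qed
    then have "real (m choose 2) * v * gauss k / (real k / 2 + 1) = gauss m"
      unfolding 3 gauss_rec v_def by (metis (no_types, opaque_lifting) times_divide_eq_left)
    moreover have "real k / 2 + 1 = real m / 2" using 3 by simp
    ultimately show ?thesis by simp
  qed
qed

text \<open>Expanding \<open>x = mart x s - \<kappa> * s\<close>, the terms with
  \<open>j \<ge> 1\<close> have bounded weights and lower powers of \<open>mart\<close>, hence are
  negligible. The normalisation uses \<open>Suc n\<close> because time \<open>n\<close> of
  \<open>E\<close> comes after \<open>n + 1\<close> steps.\<close>

lemma position_moment_limit:
  "(\<lambda>n. E n (\<lambda>x s. x ^ m) / real (Suc n) powr (real m / 2)) \<longlonglongrightarrow> gauss m"
proof -
  define \<kappa> where "\<kappa> = \<rho> / (1 - \<rho>)"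
  have eq: "E n (\<lambda>x s. x ^ m) = moment m n
      + (\<Sum>j=1..m. real (m choose j) * E n (\<lambda>x s. (- \<kappa> * s) ^ j * mart x s ^ (m - j)))" for n
  proof -
    have "x ^ m = (\<Sum>j\<le>m. real (m choose j) * ((- \<kappa> * s) ^ j * mart x s ^ (m - j)))" for x s
      using binomial_ring[of "- \<kappa> * s" "mart x s" m] by (simp add: mart_def \<kappa>_def mult.assoc)
    then have "E n (\<lambda>x s. x ^ m) =
        E n (\<lambda>x s. \<Sum>j\<le>m. real (m choose j) * ((- \<kappa> * s) ^ j * mart x s ^ (m - j)))"
      by (intro E_cong)
    also have "\<dots> = (\<Sum>j\<le>m. real (m choose j) * E n (\<lambda>x s. (- \<kappa> * s) ^ j * mart x s ^ (m - j)))"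
      by (simp add: E_sum E_cmult)
    finally show ?thesis
      by (simp add: moment_def atMost_atLeast0 sum.atLeast_Suc_atMost)
  qed
  have "(\<lambda>n. moment m n / real n powr (real m / 2) + (\<Sum>j=1..m. real (m choose j) *
        (E n (\<lambda>x s. (- \<kappa> * s) ^ j * mart x s ^ (m - j)) / real n powr (real m / 2))))
      \<longlonglongrightarrow> gauss m + (\<Sum>j=1..m. real (m choose j) * 0)"
  proof (intro tendsto_intros moment_limit weighted_negligible)
    fix j and s :: real assume "s \<in> {1, -1}"
    then show "\<bar>(- \<kappa> * s) ^ j\<bar> \<le> \<bar>\<kappa>\<bar> ^ j" by (auto simp: power_abs)
  qed auto
  then have "(\<lambda>n. E n (\<lambda>x s. x ^ m) / real n powr (real m / 2)) \<longlonglongrightarrow> gauss m"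
    by (simp add: eq add_divide_distrib sum_divide_distrib)
  moreover have "(\<lambda>n. real n powr \<alpha> / real (Suc n) powr \<alpha>) \<longlonglongrightarrow> 1" if "\<alpha> \<ge> 0" for \<alpha>
    using that by real_asymp
  ultimately have "(\<lambda>n. E n (\<lambda>x s. x ^ m) / real n powr (real m / 2) *
      (real n powr (real m / 2) / real (Suc n) powr (real m / 2))) \<longlonglongrightarrow> gauss m * 1"
    by (intro tendsto_mult) auto
  then have "(\<lambda>n. E n (\<lambda>x s. x ^ m) / real n powr (real m / 2) *
      (real n powr (real m / 2) / real (Suc n) powr (real m / 2))) \<longlonglongrightarrow> gauss m"
    by simp
  then show ?thesis
    by (rule Lim_transform_eventually)
       (auto simp: eventually_sequentially intro!: exI[of _ 1])
qed

end

subsection \<open>Reduction of the quantum walk to the persistent walk\<close>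

lemma norm_phase [simp]: "cmod (phase a) = 1"
  by transfer (simp add: norm_exp_eq_Re)

text \<open>Continuity suffices. In the quotient topology openness is tested after pulling back
  along \<open>abs_angle\<close>, which turns \<open>phase\<close> into the exponential.\<close>

lemma phase_measurable [measurable]: "phase \<in> borel_measurable borel"
proof (rule borel_measurable_continuous_onI)
  have "open (phase -` U)" if "open U" for U
  proof -
    have "abs_angle -` (phase -` U) = (\<lambda>x. exp (- (\<i> * complex_of_real x))) -` U"
      by (auto simp: phase.abs_eq)
    moreover have "open \<dots>"
      by (intro open_vimage that continuous_intros)
    ultimately show ?thesis by (simp add: open_angle_def)
  qed
  then show "continuous_on UNIV phase"
    by (simp add: continuous_on_open_vimage)
qed

lemma walk_step_components:
  "walk_step r t a b \<psi> k $ 1 = phase a * (of_real t * \<psi> (k - 1) $ 1 - of_real r * \<psi> (k - 1) $ 2)"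
  "walk_step r t a b \<psi> k $ 2 = phase b * (of_real r * \<psi> (k + 1) $ 1 + of_real t * \<psi> (k + 1) $ 2)"
  by (simp_all add: walk_step_def shift_components tensor_id_def coin_def matrix_vector_mult_def
      sum_2 algebra_simps)

text \<open>Each step moves amplitudes by one site. This reduces all later sums over sites to finite
  ones.\<close>

lemma evolution_support:
  assumes "int n < \<bar>k\<bar>"
  shows "evolution r t up down n (tensor \<phi> (ket 0)) k = 0"
  using assms
proof (induction n arbitrary: k)
  case 0
  then show ?case by (auto simp: tensor_def ket_def)
next
  case (Suc n)
  then have "int n < \<bar>k - 1\<bar>" "int n < \<bar>k + 1\<bar>" by auto
  with Suc.IH show ?case
    by (simp add: vec_eq_iff forall_2 walk_step_components)
qed

lemma evolution_cong:
  assumes "\<And>i. 1 \<le> i \<Longrightarrow> i \<le> int n \<Longrightarrow> up i = up' i \<and> down i = down' i"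
  shows "evolution r t up down n = evolution r t up' down' n"
  using assms by (induction n) (auto simp del: of_nat_Suc)

text \<open>The space \<open>N\<close> is arbitrary in order to cover both the sample space and a
  product space of phases lacking one later coordinate.\<close>

lemma evolution_measurable:
  fixes up down :: "int \<Rightarrow> 'b \<Rightarrow> angle"
  assumes "\<And>i. 1 \<le> i \<Longrightarrow> i \<le> int n \<Longrightarrow> up i \<in> borel_measurable N"
    and "\<And>i. 1 \<le> i \<Longrightarrow> i \<le> int n \<Longrightarrow> down i \<in> borel_measurable N"
  shows "(\<lambda>x. evolution r t (\<lambda>i. up i x) (\<lambda>i. down i x) n \<psi> k $ s) \<in> borel_measurable N"
  using assms
proof (induction n arbitrary: k s)
  case (Suc n)
  have [measurable]: "up (int (Suc n)) \<in> borel_measurable N" "down (int (Suc n)) \<in> borel_measurable N"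
    by (rule Suc.prems; simp)+
  have [measurable]:
    "(\<lambda>x. evolution r t (\<lambda>i. up i x) (\<lambda>i. down i x) n \<psi> k $ s) \<in> borel_measurable N" for k s
    by (rule Suc.IH) (use Suc.prems in auto)
  have "s = 1 \<or> s = 2" by (metis exhaust_2)
  then show ?case
    by (elim disjE) (simp_all add: walk_step_components del: of_nat_Suc)
qed simp

text \<open>The coin entries have modulus at most 1, so a step at most doubles the bound. This crude
  estimate serves integrability.\<close>

lemma evolution_bound:
  assumes "0 \<le> r" "r \<le> 1" "0 \<le> t" "t \<le> 1"
  shows "cmod (evolution r t up down n (tensor \<phi> (ket 0)) k $ s) \<le> 2 ^ n * norm \<phi>"
proof (induction n arbitrary: k s)
  case 0
  show ?case using Finite_Cartesian_Product.norm_nth_le[of \<phi> s] by (simp add: tensor_def ket_def)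
next
  case (Suc n)
  let ?\<psi> = "evolution r t up down n (tensor \<phi> (ket 0))"
  have *: "cmod (of_real c * ?\<psi> j $ i) \<le> 2 ^ n * norm \<phi>" if "0 \<le> c" "c \<le> 1" for c j i
    using mult_mono[OF that(2) Suc.IH[of j i]] that by (simp add: norm_mult)
  have "s = 1 \<or> s = 2" by (metis exhaust_2)
  then show ?case
  proof
    assume "s = 1"
    then show ?thesis
      using norm_triangle_ineq4[of "of_real t * ?\<psi> (k - 1) $ 1" "of_real r * ?\<psi> (k - 1) $ 2"]
        *[of t "k - 1" 1] *[of r "k - 1" 2] assms
      by (simp add: walk_step_components norm_mult)
  next
    assume "s = 2"
    then show ?thesis
      using norm_triangle_ineq[of "of_real r * ?\<psi> (k + 1) $ 1" "of_real t * ?\<psi> (k + 1) $ 2"]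
        *[of r "k + 1" 1] *[of t "k + 1" 2] assms
      by (simp add: walk_step_components norm_mult)
  qed
qed

section \<open>Position moments as finite sums\<close>

lemma position_power: "(position ^^ L) \<psi> k = of_int k ^ L *s \<psi> k"
  by (induction L arbitrary: k) (simp_all add: position_def vector_smult_assoc)

lemma summable_on_finite_support:
  fixes f :: "int \<Rightarrow> 'b :: {comm_monoid_add, topological_space}"
  assumes "\<And>k. int n < \<bar>k\<bar> \<Longrightarrow> f k = 0"
  shows "f summable_on UNIV"
proof -
  have "f summable_on {- int n..int n}" by simp
  then show ?thesis
    by (rule summable_on_cong_neutral[THEN iffD1, rotated -1]) (use assms in auto)
qed

lemma infsum_finite_support:
  fixes f :: "int \<Rightarrow> 'b :: {comm_monoid_add, t2_space}"
  assumes "\<And>k. int n < \<bar>k\<bar> \<Longrightarrow> f k = 0"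
  shows "infsum f UNIV = sum f {- int n..int n}"
proof -
  have "infsum f UNIV = infsum f {- int n..int n}"
    by (intro infsum_cong_neutral) (use assms in auto)
  then show ?thesis by simp
qed

lemma l2_inner_commute: "l2_inner \<phi> \<psi> = cnj (l2_inner \<psi> \<phi>)"
  unfolding l2_inner_def infsum_cnj[symmetric] by (simp add: mult.commute)

text \<open>The adjoint carries \<open>U\<close> to the other side of the inner product. Finite
  support puts \<open>(position ^^ L) \<psi>\<close> into \<open>l2\<close>, where
  \<open>adj\<close> is characterised.\<close>

lemma position_moment_eq:
  fixes r t up down n \<phi>
  defines "\<psi> \<equiv> evolution r t up down n (tensor \<phi> (ket 0))"
  shows "position_moment r t up down L (tensor \<phi> (ket 0)) n =
    of_real (\<Sum>k\<in>{- int n..int n}. of_int k ^ L * ((cmod (\<psi> k $ 1))\<^sup>2 + (cmod (\<psi> k $ 2))\<^sup>2))"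
proof -
  let ?U = "evolution r t up down n" and ?\<Psi> = "tensor \<phi> (ket 0)"
  have supp: "\<psi> k = 0" if "int n < \<bar>k\<bar>" for k
    unfolding \<psi>_def using that by (rule evolution_support)
  have "?\<Psi> \<in> l2"
    unfolding l2_def mem_Collect_eq
    by (rule summable_on_finite_support[of 0]) (auto simp: tensor_def ket_def)
  moreover have "(position ^^ L) \<psi> \<in> l2"
    unfolding l2_def mem_Collect_eq
    by (rule summable_on_finite_support[of n]) (auto simp: position_power supp)
  moreover have "is_adjoint ?U (adj ?U)"
    unfolding adj_def using has_adjoint_evolution by (rule someI_ex)
  ultimately have "l2_inner (adj ?U ((position ^^ L) \<psi>)) ?\<Psi> = l2_inner ((position ^^ L) \<psi>) \<psi>"
    by (simp add: is_adjoint_def \<psi>_def)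
  \<comment> \<open>\<open>is_adjoint\<close> has the adjoint in the first slot, so both inner
    products are conjugated.\<close>
  then have "position_moment r t up down L ?\<Psi> n = l2_inner \<psi> ((position ^^ L) \<psi>)"
    unfolding position_moment_def Let_def \<psi>_def[symmetric]
    by (subst (1 2) l2_inner_commute) simp
  also have "\<dots> = (\<Sum>k\<in>{- int n..int n}. \<Sum>s\<in>UNIV. cnj (\<psi> k $ s) * (position ^^ L) \<psi> k $ s)"
    unfolding l2_inner_def by (rule infsum_finite_support) (simp add: supp)
  also have "\<dots> = of_real (\<Sum>k\<in>{- int n..int n}. of_int k ^ L * ((cmod (\<psi> k $ 1))\<^sup>2 + (cmod (\<psi> k $ 2))\<^sup>2))"
    unfolding of_real_sum of_real_mult of_real_add complex_norm_square
    by (intro sum.cong refl) (simp add: sum_2 position_power algebra_simps)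
  finally show ?thesis .
qed

lemma cnj_measurable [measurable]: "cnj \<in> borel_measurable borel"
  by (intro borel_measurable_continuous_onI continuous_intros)

lemma cmod_sq_of_real_mult_add:
  "(cmod (of_real a * z + of_real b * w))\<^sup>2 = a\<^sup>2 * (cmod z)\<^sup>2 + b\<^sup>2 * (cmod w)\<^sup>2 + 2 * a * b * Re (cnj z * w)"
  by (simp add: cmod_power2) (simp add: power2_eq_square algebra_simps)

section \<open>Averaging over the phases\<close>

locale random_phase_walk = prob_space M for M :: "'a measure" +
  fixes up down :: "int \<Rightarrow> 'a \<Rightarrow> angle" and r t :: real and \<phi> :: "complex^2"
  assumes indep: "indep_vars (\<lambda>_. borel) (case_sum up down) UNIV"
    and mean_down: "\<And>k. (\<integral>x. phase (down k x) \<partial>M) = 0"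
    and rt: "0 \<le> r" "r \<le> 1" "0 \<le> t" "t \<le> 1" "r\<^sup>2 + t\<^sup>2 = 1"
    and r_nonzero: "r \<noteq> 0"
    and norm_\<phi>: "(cmod (\<phi> $ 1))\<^sup>2 + (cmod (\<phi> $ 2))\<^sup>2 = 1"
begin

definition "state n x = evolution r t (\<lambda>i. up i x) (\<lambda>i. down i x) n (tensor \<phi> (ket 0))"

lemma measurable_up [measurable]: "up i \<in> borel_measurable M"
  and measurable_down [measurable]: "down i \<in> borel_measurable M"
proof -
  have "case_sum up down j \<in> borel_measurable M" for j
    using indep by (auto simp: indep_vars_def)
  from this[of "Inl i"] this[of "Inr i"]
  show "up i \<in> borel_measurable M" "down i \<in> borel_measurable M" by simp_all
qed

lemma state_measurable [measurable]: "(\<lambda>x. state n x k $ s) \<in> borel_measurable M"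
  unfolding state_def by (rule evolution_measurable) simp_all

lemma state_bound: "cmod (state n x k $ s) \<le> 2 ^ n * norm \<phi>"
  unfolding state_def by (rule evolution_bound) (use rt in auto)

lemma state_Suc:
  "state (Suc n) x k $ 1 = phase (up (int (Suc n)) x) *
     (of_real t * state n x (k - 1) $ 1 - of_real r * state n x (k - 1) $ 2)"
  "state (Suc n) x k $ 2 = phase (down (int (Suc n)) x) *
     (of_real r * state n x (k + 1) $ 1 + of_real t * state n x (k + 1) $ 2)"
  by (simp_all add: state_def walk_step_components del: of_nat_Suc)

lemma integrable_cross: "integrable M (\<lambda>x. cnj (state n x k $ i) * state n x l $ j)"
proof (rule integrable_const_bound)
  show "AE x in M. norm (cnj (state n x k $ i) * state n x l $ j) \<le> (2 ^ n * norm \<phi>) * (2 ^ n * norm \<phi>)"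
    unfolding norm_mult complex_mod_cnj
    by (intro AE_I2 mult_mono state_bound) auto
qed simp

lemma integrable_norm_sq: "integrable M (\<lambda>x. (cmod (state n x k $ i))\<^sup>2)"
proof -
  have "(\<lambda>x. (cmod (state n x k $ i))\<^sup>2) = (\<lambda>x. Re (cnj (state n x k $ i) * state n x k $ i))"
    by (simp add: fun_eq_iff cmod_power2) (simp add: power2_eq_square)
  then show ?thesis using integrable_Re[OF integrable_cross[of n k i k i]] by (simp only:)
qed

lemma cross_expectation:
  "(\<integral>x. cnj (state (Suc n) x k $ 1) * state (Suc n) x k $ 2 \<partial>M) = 0"
proof -
  \<comment> \<open>The phase \<open>down (n + 1)\<close> occurs in the second factor only, hence is independent of all the rest.\<close>
  define X where "X = case_sum up down"
  define N where "N = int (Suc n)"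
  define A where "A = (UNIV :: (int + int) set) - {Inr N}"
  define ev where "ev f = evolution r t (\<lambda>i. f (Inl i)) (\<lambda>i. f (Inr i)) n (tensor \<phi> (ket 0))"
    for f :: "int + int \<Rightarrow> angle"
  \<comment> \<open>\<open>H\<close> is the product of the two components without the phase
    \<open>down N\<close>, and \<open>G\<close> is that phase.\<close>
  define H where "H f = cnj (phase (f (Inl N)) *
      (of_real t * ev f (k - 1) $ 1 - of_real r * ev f (k - 1) $ 2)) *
      (of_real r * ev f (k + 1) $ 1 + of_real t * ev f (k + 1) $ 2)" for f
  define G where "G f = phase (f (Inr N))" for f :: "int + int \<Rightarrow> angle"
  define RA where "RA x = restrict (\<lambda>i. X i x) A" for x
  define RB where "RB x = restrict (\<lambda>i. X i x) {Inr N}" for x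
  have "indep_var (PiM A (\<lambda>_. borel)) RA (PiM {Inr N} (\<lambda>_. borel)) RB"
    unfolding RA_def RB_def X_def by (rule indep_var_restrict[OF indep]) (auto simp: A_def)
  moreover have "H \<in> borel_measurable (PiM A (\<lambda>_. borel))"
  proof -
    have [measurable]: "(\<lambda>f. ev f j $ s) \<in> borel_measurable (PiM A (\<lambda>_. borel))" for j s
      unfolding ev_def
      by (rule evolution_measurable) (auto simp: A_def N_def intro!: measurable_component_singleton)
    have [measurable]: "(\<lambda>f. f (Inl N)) \<in> borel_measurable (PiM A (\<lambda>_. borel))"
      by (rule measurable_component_singleton) (simp add: A_def)
    show ?thesis unfolding H_def by measurable
  qed
  moreover have "G \<in> borel_measurable (PiM {Inr N} (\<lambda>_. borel))"
  proof -
    have [measurable]: "(\<lambda>f. f (Inr N)) \<in> borel_measurable (PiM {Inr N} (\<lambda>_. borel))"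
      by (rule measurable_component_singleton) simp
    show ?thesis unfolding G_def by measurable
  qed
  ultimately have ind: "indep_var borel (H \<circ> RA) borel (G \<circ> RB)"
    by (rule indep_var_compose)
  \<comment> \<open>The first \<open>n\<close> steps use phases of times 1 to \<open>n\<close> only,
    so dropping the coordinate \<open>Inr N\<close> changes nothing.\<close>
  have ev: "ev (RA x) = state n x" for x
    unfolding ev_def state_def
    by (rule fun_cong[OF evolution_cong]) (auto simp: RA_def A_def X_def N_def)
  have prod: "(H \<circ> RA) x * (G \<circ> RB) x = cnj (state (Suc n) x k $ 1) * state (Suc n) x k $ 2" for x
  proof -
    have "RA x (Inl N) = up N x" "RB x (Inr N) = down N x"
      by (simp_all add: RA_def RB_def A_def X_def)
    then show ?thesis
      by (simp add: H_def G_def ev state_Suc N_def[symmetric] del: of_nat_Suc)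
  qed
  have G: "(G \<circ> RB) x = phase (down N x)" for x
    by (simp add: G_def RB_def X_def)
  have "integrable M (H \<circ> RA)"
  proof (rule integrable_const_bound)
    have "norm ((H \<circ> RA) x) \<le> (2 ^ Suc n * norm \<phi>) * (2 ^ Suc n * norm \<phi>)" for x
    proof -
      \<comment> \<open>The missing factor \<open>G\<close> has modulus 1, so the bounds on the
        components carry over to \<open>H\<close>.\<close>
      have "norm ((H \<circ> RA) x) = cmod (state (Suc n) x k $ 1) * cmod (state (Suc n) x k $ 2)"
        using arg_cong[OF prod[of x], of cmod] by (simp add: norm_mult G del: comp_apply)
      also have "\<dots> \<le> (2 ^ Suc n * norm \<phi>) * (2 ^ Suc n * norm \<phi>)"
        by (intro mult_mono state_bound) auto
      finally show ?thesis .
    qed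
    then show "AE x in M. norm ((H \<circ> RA) x) \<le> (2 ^ Suc n * norm \<phi>) * (2 ^ Suc n * norm \<phi>)"
      by simp
    show "H \<circ> RA \<in> borel_measurable M" using indep_var_rv1[OF ind] .
  qed
  moreover have "integrable M (G \<circ> RB)"
  proof (rule integrable_const_bound)
    show "AE x in M. norm ((G \<circ> RB) x) \<le> 1" by (simp add: G del: comp_apply)
    show "G \<circ> RB \<in> borel_measurable M" using indep_var_rv2[OF ind] .
  qed
  ultimately have "(\<integral>x. (H \<circ> RA) x * (G \<circ> RB) x \<partial>M) = (\<integral>x. (H \<circ> RA) x \<partial>M) * (\<integral>x. (G \<circ> RB) x \<partial>M)"
    using ind by (intro indep_var_lebesgue_integral)
  then show ?thesis unfolding prod unfolding G by (simp add: mean_down)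
qed

section \<open>The averaged distribution of spin and position\<close>

text \<open>Spin up moves right and spin down moves left, so from time 1 on the spin records the
  direction of the last step.\<close>

definition "up_prob n k = (\<integral>x. (cmod (state n x k $ 1))\<^sup>2 \<partial>M)"

definition "down_prob n k = (\<integral>x. (cmod (state n x k $ 2))\<^sup>2 \<partial>M)"

lemma prob_support:
  assumes "int n < \<bar>k\<bar>"
  shows "up_prob n k = 0" "down_prob n k = 0"
  using evolution_support[OF assms] by (simp_all add: up_prob_def down_prob_def state_def)

text \<open>The phases of the last step drop out of the moduli, and the interference term averages
  to 0 by \<open>cross_expectation\<close>. The latter needs a preceding step, so the recursion
  starts at time 1.\<close>

lemma prob_Suc_Suc:
  "up_prob (Suc (Suc n)) k = t\<^sup>2 * up_prob (Suc n) (k - 1) + r\<^sup>2 * down_prob (Suc n) (k - 1)"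
  "down_prob (Suc (Suc n)) k = r\<^sup>2 * up_prob (Suc n) (k + 1) + t\<^sup>2 * down_prob (Suc n) (k + 1)"
proof -
  have *: "(\<integral>x. (cmod (of_real a * state (Suc n) x j $ 1 + of_real b * state (Suc n) x j $ 2))\<^sup>2 \<partial>M)
      = a\<^sup>2 * up_prob (Suc n) j + b\<^sup>2 * down_prob (Suc n) j" for a b j
    unfolding cmod_sq_of_real_mult_add up_prob_def down_prob_def
    using integrable_cross[of "Suc n" j 1 j 2] integrable_norm_sq[of "Suc n" j]
      integral_Re[OF integrable_cross[of "Suc n" j 1 j 2]] cross_expectation[of n j]
    by (simp del: times_complex.simps)
  show "up_prob (Suc (Suc n)) k = t\<^sup>2 * up_prob (Suc n) (k - 1) + r\<^sup>2 * down_prob (Suc n) (k - 1)"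
    using *[of t "k - 1" "- r"] by (simp add: up_prob_def state_Suc[of "Suc n"] norm_mult)
  show "down_prob (Suc (Suc n)) k = r\<^sup>2 * up_prob (Suc n) (k + 1) + t\<^sup>2 * down_prob (Suc n) (k + 1)"
    using *[of r "k + 1" t] by (simp add: down_prob_def state_Suc[of "Suc n"] norm_mult)
qed

text \<open>The probability that the first step is up. The interference within the deterministic
  \<open>\<phi>\<close> is still present here.\<close>

definition "p = (cmod (of_real t * \<phi> $ 1 - of_real r * \<phi> $ 2))\<^sup>2"

definition "\<rho> = t\<^sup>2 - r\<^sup>2"

text \<open>Up to phases the coin is a rotation: the two interference terms have opposite signs and
  cancel.\<close>

lemma p_complement: "(cmod (of_real r * \<phi> $ 1 + of_real t * \<phi> $ 2))\<^sup>2 = 1 - p"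
proof -
  have "(cmod (of_real r * \<phi> $ 1 + of_real t * \<phi> $ 2))\<^sup>2 + p =
      (r\<^sup>2 + t\<^sup>2) * ((cmod (\<phi> $ 1))\<^sup>2 + (cmod (\<phi> $ 2))\<^sup>2)"
    using cmod_sq_of_real_mult_add[of t "\<phi> $ 1" "- r" "\<phi> $ 2"]
    by (simp add: p_def cmod_sq_of_real_mult_add algebra_simps)
  then show ?thesis using norm_\<phi> rt by simp
qed

lemma prob_1:
  "up_prob (Suc 0) k = (if k = 1 then p else 0)"
  "down_prob (Suc 0) k = (if k = -1 then 1 - p else 0)"
proof -
  have "state 0 x j = (if j = 0 then \<phi> else 0)" for x j
    by (simp add: state_def tensor_def ket_def)
  then show "up_prob (Suc 0) k = (if k = 1 then p else 0)"
    "down_prob (Suc 0) k = (if k = -1 then 1 - p else 0)"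
    by (auto simp: up_prob_def down_prob_def state_Suc norm_mult prob_space p_complement) (simp_all add: p_def)
qed

sublocale persistent_walk p \<rho>
proof
  show "0 \<le> p" by (simp add: p_def)
  show "p \<le> 1" using p_complement zero_le_power2[of "cmod (of_real r * \<phi> $ 1 + of_real t * \<phi> $ 2)"] by linarith
  show "-1 \<le> \<rho>" using rt zero_le_power2[of t] unfolding \<rho>_def by linarith
  have "0 < r\<^sup>2" using r_nonzero by simp
  then show "\<rho> < 1" using rt(5) unfolding \<rho>_def by linarith
qed

text \<open>By duality, the recursion of the averaged probabilities becomes \<open>T\<close> acting
  on the test function, and \<open>E_Suc\<close> closes the induction.\<close>

lemma expectation_eq_walk:
  "(\<Sum>\<^sub>\<infinity>k. up_prob (Suc n) k * g (of_int k) 1 + down_prob (Suc n) k * g (of_int k) (-1)) = E n g"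
proof (induction n arbitrary: g)
  case 0
  have "(\<Sum>\<^sub>\<infinity>k. up_prob (Suc 0) k * g (of_int k) 1 + down_prob (Suc 0) k * g (of_int k) (-1))
      = (\<Sum>k\<in>{- int 1..int 1}. up_prob (Suc 0) k * g (of_int k) 1 + down_prob (Suc 0) k * g (of_int k) (-1))"
    by (rule infsum_finite_support) (simp add: prob_support)
  also have "{- int 1..int 1} = {-1, 0, 1}" by auto
  finally show ?case by (simp add: prob_1 E_0)
next
  case (Suc n)
  let ?u = "up_prob (Suc n)" and ?v = "down_prob (Suc n)"
  let ?f = "\<lambda>k. (t\<^sup>2 * ?u k + r\<^sup>2 * ?v k) * g (of_int k + 1) 1"
  let ?h = "\<lambda>k. (r\<^sup>2 * ?u k + t\<^sup>2 * ?v k) * g (of_int k - 1) (-1)"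
  have summable: "?f summable_on UNIV" "?h summable_on UNIV"
    by (rule summable_on_finite_support[of "Suc n"]; simp add: prob_support)+
  \<comment> \<open>Both summands are expressed through the site left by the last step; index shifts
    then align them.\<close>
  have "(\<Sum>\<^sub>\<infinity>k. up_prob (Suc (Suc n)) k * g (of_int k) 1 + down_prob (Suc (Suc n)) k * g (of_int k) (-1))
      = (\<Sum>\<^sub>\<infinity>k. ?f (k + (-1)) + ?h (k + 1))"
    by (simp add: prob_Suc_Suc)
  also have "\<dots> = infsum ?f UNIV + infsum ?h UNIV"
    using summable_shift[where a = "-1" and f = ?f] summable_shift[where a = 1 and f = ?h] summable
    by (subst infsum_add) (simp_all only: infsum_shift[where a = "-1" and f = ?f] infsum_shift[where a = 1 and f = ?h])
  also have "\<dots> = (\<Sum>\<^sub>\<infinity>k. ?f k + ?h k)"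
    using summable by (simp add: infsum_add)
  also have "\<dots> = (\<Sum>\<^sub>\<infinity>k. ?u k * T g (of_int k) 1 + ?v k * T g (of_int k) (-1))"
  proof (rule infsum_cong)
    fix k
    \<comment> \<open>A step is repeated with probability \<open>t\<^sup>2\<close> and reversed with
      probability \<open>r\<^sup>2\<close>.\<close>
    have t2: "t\<^sup>2 = (1 + \<rho>) / 2" and r2: "r\<^sup>2 = (1 - \<rho>) / 2"
      using rt(5) by (simp_all add: \<rho>_def field_simps)
    then show "?f k + ?h k = ?u k * T g (of_int k) 1 + ?v k * T g (of_int k) (-1)"
      by (simp add: walk_op_def t2 r2 field_simps)
  qed
  finally show ?case by (simp add: Suc.IH E_Suc)
qed

text \<open>The first step belongs to the initial law of the persistent walk, so time
  \<open>Suc n\<close> here is time \<open>n\<close> there.\<close>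

lemma expectation_position_moment:
  "(\<integral>x. position_moment r t (\<lambda>i. up i x) (\<lambda>i. down i x) L (tensor \<phi> (ket 0)) (Suc n) \<partial>M) =
    of_real (E n (\<lambda>x s. x ^ L))"
proof -
  have "(\<integral>x. position_moment r t (\<lambda>i. up i x) (\<lambda>i. down i x) L (tensor \<phi> (ket 0)) (Suc n) \<partial>M) =
     of_real (\<integral>x. (\<Sum>k\<in>{- int (Suc n)..int (Suc n)}. of_int k ^ L *
       ((cmod (state (Suc n) x k $ 1))\<^sup>2 + (cmod (state (Suc n) x k $ 2))\<^sup>2)) \<partial>M)"
    unfolding position_moment_eq state_def[symmetric] by (rule integral_complex_of_real)
  also have "(\<integral>x. (\<Sum>k\<in>{- int (Suc n)..int (Suc n)}. of_int k ^ L *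
       ((cmod (state (Suc n) x k $ 1))\<^sup>2 + (cmod (state (Suc n) x k $ 2))\<^sup>2)) \<partial>M)
     = (\<Sum>k\<in>{- int (Suc n)..int (Suc n)}.
         up_prob (Suc n) k * of_int k ^ L + down_prob (Suc n) k * of_int k ^ L)"
    unfolding up_prob_def down_prob_def
    by (subst Bochner_Integration.integral_sum)
       (simp_all add: integrable_norm_sq algebra_simps del: of_nat_Suc)
  also have "\<dots> = (\<Sum>\<^sub>\<infinity>k. up_prob (Suc n) k * of_int k ^ L + down_prob (Suc n) k * of_int k ^ L)"
    by (rule infsum_finite_support[symmetric]) (simp add: prob_support)
  also have "\<dots> = E n (\<lambda>x s. x ^ L)"
    by (rule expectation_eq_walk)
  finally show ?thesis .
qed

lemma gauss_eq_limit_moment: "gauss L = limit_moment r t L"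
proof -
  have "1 + \<rho> = 2 * t\<^sup>2" "1 - \<rho> = 2 * r\<^sup>2" using rt(5) unfolding \<rho>_def by linarith+
  then show ?thesis by (simp add: gauss_def limit_moment_def)
qed

end

theorem proposition2p4:
  fixes M :: "'a measure"
    and \<mu> :: "angle measure"
    and \<omega>_up \<omega>_down :: "int \<Rightarrow> 'a \<Rightarrow> angle"
    and r t :: real
    and \<phi>\<^sub>0 :: "complex^2"
    and \<Psi>\<^sub>0 :: wavefun
    and L :: nat
  assumes "0 \<le> r" "r \<le> 1" "0 \<le> t" "t \<le> 1" "r\<^sup>2 + t\<^sup>2 = 1"
    and "r \<noteq> 0"
    and "prob_space M"
    and "prob_space \<mu>" "sets \<mu> = sets borel"
    and "prob_space.indep_vars M (\<lambda>_. borel) (case_sum \<omega>_up \<omega>_down) UNIV"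
    and "\<And>k. distr M borel (\<omega>_up k) = \<mu>"
    and "\<And>k. distr M borel (\<omega>_down k) = \<mu>"
    and "\<And>k. (\<integral>x. phase (\<omega>_up k x) \<partial>M) = 0"
    and "\<And>k. (\<integral>x. phase (\<omega>_down k x) \<partial>M) = 0"
    and "\<Psi>\<^sub>0 = tensor \<phi>\<^sub>0 (ket 0)" "l2_norm \<Psi>\<^sub>0 = 1"
  shows "(\<lambda>n. (\<integral>x. position_moment r t (\<lambda>k. \<omega>_up k x) (\<lambda>k. \<omega>_down k x) L \<Psi>\<^sub>0 n \<partial>M)
              / of_real (real n powr (real L / 2)))
         \<longlonglongrightarrow> of_real (limit_moment r t L)"
proof -
  have "l2_inner \<Psi>\<^sub>0 \<Psi>\<^sub>0 = (\<Sum>k\<in>{- int 0..int 0}. \<Sum>s\<in>UNIV. cnj (\<Psi>\<^sub>0 k $ s) * \<Psi>\<^sub>0 k $ s)"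
    unfolding l2_inner_def by (rule infsum_finite_support) (auto simp: assms(15) tensor_def ket_def)
  also have "\<dots> = of_real ((cmod (\<phi>\<^sub>0 $ 1))\<^sup>2 + (cmod (\<phi>\<^sub>0 $ 2))\<^sup>2)"
    by (simp add: assms(15) tensor_def ket_def sum_2 complex_norm_square mult.commute del: of_real_power)
  finally have "(cmod (\<phi>\<^sub>0 $ 1))\<^sup>2 + (cmod (\<phi>\<^sub>0 $ 2))\<^sup>2 = 1"
    using assms(16) by (simp add: l2_norm_def)
  then interpret random_phase_walk M \<omega>_up \<omega>_down r t \<phi>\<^sub>0
    using assms by (auto intro!: random_phase_walk.intro random_phase_walk_axioms.intro)
  \<comment> \<open>The limit is taken along \<open>Suc n\<close>, the times that \<open>E n\<close>
    describes.\<close>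
  show ?thesis
    using tendsto_of_real[OF position_moment_limit[of L], where 'a = complex]
    by (subst filterlim_sequentially_Suc[symmetric])
       (simp add: assms(15) expectation_position_moment gauss_eq_limit_moment del: of_nat_Suc)
qed

end
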